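(* Let $d\ge 2$ and $n\ge 1$, let $T_n$ be the complete $d$-ary rooted tree of height $n$, and let $R_n$ denote the set of vertices of level $n$. Let $E \subseteq R_n$ be any set containing points in at least two major branches. Suppose that $G \leq \mathrm{Aut}(T_n)$ contains an element $\sigma$ acting on $R_n$ as a full $d^n$-cycle. Suppose also that the restriction $G_1$ of $G$ to the set $R_1$ of vertices of level $1$ acts primitively on $R_1$. Then the smallest $G$-block of $R_n$ containing $E$ is all of $R_n$.
   Context: In the complete $d$-ary rooted tree $T_n$, level $0$ consists of the root, every vertex at level less than $n$ has exactly $d$ children at the next level, and $R_n$ (the top level) has $d^n$ vertices. $\mathrm{Aut}(T_n)$ is the group of automorphisms of $T_n$ as a rooted tree; it acts on every level. The major branches of $R_n$ are the $d$ sets, one for each vertex $x\in R_1$, consisting of all vertices of $R_n$ that are descendants of $x$ (with $\{x\}$ itself if $n=1$). If a group $G$ acts on a finite set $S$, a subset $E\subseteq S$ is a $G$-block if for every $g\in G$ the set $g(E)\cap E$ is equal to either $E$ or $\emptyset$. The action is primitive if the only (nonempty) $G$-blocks of $S$ are single points and all of $S$. *)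

theory Defs
  imports
    "HOL-Algebra.Group_Action"
    "HOL-Combinatorics.Cycles"
    "HOL-Library.Sublist"
begin

section \<open>The complete \<open>d\<close>-ary rooted tree of height \<open>n\<close>\<close>

text \<open>
  A vertex is the word of choices made on the way down from the root \<open>[]\<close>, so the children
  of \<open>u\<close> are the words \<open>u @ [i]\<close> with \<open>i < d\<close>, and the descendants of \<open>u\<close> (with \<open>u\<close> itself
  included) are the words that have \<open>u\<close> as a prefix.
\<close>

definition tree_level :: "nat \<Rightarrow> nat \<Rightarrow> nat list set" where
  "tree_level d k = {w. length w = k \<and> set w \<subseteq> {..<d}}"

definition tree_verts :: "nat \<Rightarrow> nat \<Rightarrow> nat list set" where
  "tree_verts d n = (\<Union>k\<le>n. tree_level d k)"

definition tree_adj :: "nat list \<Rightarrow> nat list \<Rightarrow> bool" where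
  "tree_adj u v \<longleftrightarrow> (\<exists>i. v = u @ [i]) \<or> (\<exists>i. u = v @ [i])"

definition tree_aut :: "nat \<Rightarrow> nat \<Rightarrow> (nat list \<Rightarrow> nat list) set" where
  "tree_aut d n = {f \<in> Bij (tree_verts d n). f [] = [] \<and>
     (\<forall>u\<in>tree_verts d n. \<forall>v\<in>tree_verts d n. tree_adj (f u) (f v) \<longleftrightarrow> tree_adj u v)}"

definition TreeAutGroup :: "nat \<Rightarrow> nat \<Rightarrow> (nat list \<Rightarrow> nat list) monoid" where
  "TreeAutGroup d n = BijGroup (tree_verts d n) \<lparr>carrier := tree_aut d n\<rparr>"

definition level_action :: "nat \<Rightarrow> nat \<Rightarrow> (nat list \<Rightarrow> nat list) \<Rightarrow> nat list \<Rightarrow> nat list" where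
  "level_action d k g = restrict g (tree_level d k)"

text \<open>The group of permutations of level \<open>k\<close> induced by \<open>G\<close>.\<close>

definition restricted_group ::
  "nat \<Rightarrow> nat \<Rightarrow> (nat list \<Rightarrow> nat list) set \<Rightarrow> (nat list \<Rightarrow> nat list) monoid" where
  "restricted_group d k G = BijGroup (tree_level d k) \<lparr>carrier := level_action d k ` G\<rparr>"

definition major_branch :: "nat \<Rightarrow> nat \<Rightarrow> nat list \<Rightarrow> nat list set" where
  "major_branch d n x = {v \<in> tree_level d n. prefix x v}"

definition major_branches :: "nat \<Rightarrow> nat \<Rightarrow> nat list set set" where
  "major_branches d n = major_branch d n ` tree_level d 1"


section \<open>Blocks, primitive actions, full cycles\<close>

text \<open>
  As in the library's locale \<open>group_action\<close>, \<open>\<phi> g\<close> is the permutation of \<open>S\<close> by which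
  \<open>g \<in> carrier G\<close> acts.
\<close>

definition is_block ::
  "('g, 'm) monoid_scheme \<Rightarrow> 'a set \<Rightarrow> ('g \<Rightarrow> 'a \<Rightarrow> 'a) \<Rightarrow> 'a set \<Rightarrow> bool" where
  "is_block G S \<phi> B \<longleftrightarrow>
     B \<subseteq> S \<and> (\<forall>g\<in>carrier G. \<phi> g ` B \<inter> B = B \<or> \<phi> g ` B \<inter> B = {})"

definition is_smallest_block ::
  "('g, 'm) monoid_scheme \<Rightarrow> 'a set \<Rightarrow> ('g \<Rightarrow> 'a \<Rightarrow> 'a) \<Rightarrow> 'a set \<Rightarrow> 'a set \<Rightarrow> bool" where
  "is_smallest_block G S \<phi> E B \<longleftrightarrow>
     is_block G S \<phi> B \<and> E \<subseteq> B \<and> (\<forall>C. is_block G S \<phi> C \<and> E \<subseteq> C \<longrightarrow> B \<subseteq> C)"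

definition primitive_action ::
  "('g, 'm) monoid_scheme \<Rightarrow> 'a set \<Rightarrow> ('g \<Rightarrow> 'a \<Rightarrow> 'a) \<Rightarrow> bool" where
  "primitive_action G S \<phi> \<longleftrightarrow>
     (\<forall>B. is_block G S \<phi> B \<and> B \<noteq> {} \<longrightarrow> (\<exists>x\<in>S. B = {x}) \<or> B = S)"

definition acts_as_full_cycle :: "('a \<Rightarrow> 'a) \<Rightarrow> 'a set \<Rightarrow> bool" where
  "acts_as_full_cycle s S \<longleftrightarrow>
     (\<exists>cs. cycle cs \<and> set cs = S \<and> (\<forall>x\<in>S. s x = cycle_of_list cs x))"


section \<open>The tree automorphisms form a group acting on every level\<close>

lemma finite_tree_level: "finite (tree_level d k)"
  and card_tree_level: "card (tree_level d k) = d ^ k"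
proof -
  have "tree_level d k = {w. set w \<subseteq> {..<d} \<and> length w = k}"
    by (auto simp: tree_level_def)
  then show "finite (tree_level d k)" "card (tree_level d k) = d ^ k"
    by (simp_all add: finite_lists_length_eq card_lists_length_eq)
qed

lemma tree_aut_maps_level:
  assumes f: "f \<in> tree_aut d n" and "k \<le> n" "u \<in> tree_level d k"
  shows "f u \<in> tree_level d k"
  using assms(2,3)
proof (induction k arbitrary: u rule: less_induct)
  case (less k)
  have fB: "bij_betw f (tree_verts d n) (tree_verts d n)" and f0: "f [] = []"
    and adj: "\<And>u v. u \<in> tree_verts d n \<Longrightarrow> v \<in> tree_verts d n \<Longrightarrow>
                tree_adj (f u) (f v) \<longleftrightarrow> tree_adj u v"
    using f by (auto simp: tree_aut_def Bij_def)
  have V: "w \<in> tree_verts d n \<longleftrightarrow> length w \<le> n \<and> set w \<subseteq> {..<d}" for w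
    by (auto simp: tree_verts_def tree_level_def)
  show ?case
  proof (cases k)
    case 0
    then show ?thesis using less.prems f0 by (simp add: tree_level_def)
  next
    case (Suc j)
    with less.prems obtain p i where u: "u = p @ [i]" and p: "p \<in> tree_level d j"
      by (cases u rule: rev_cases) (auto simp: tree_level_def)
    have uV: "u \<in> tree_verts d n" and pV: "p \<in> tree_verts d n"
      using less.prems u by (auto simp: V tree_level_def)
    have fp: "f p \<in> tree_level d j"
      using less.IH[of j p] less.prems p Suc by simp
    have fuV: "f u \<in> tree_verts d n"
      using bij_betwE[OF fB] uV by blast
    have "tree_adj (f p) (f u)"
      using adj[OF pV uV] by (simp add: tree_adj_def u)
    then consider a where "f u = f p @ [a]" | a where "f p = f u @ [a]"
      by (auto simp: tree_adj_def)
    then show ?thesis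
    proof cases
      case 1
      then have "length (f u) = k" using fp Suc by (simp add: tree_level_def)
      moreover have "set (f u) \<subseteq> {..<d}" using fuV unfolding V by blast
      ultimately show ?thesis by (simp add: tree_level_def)
    next
      case 2
      then obtain m where m: "j = Suc m" using fp by (cases j) (auto simp: tree_level_def)
      with p obtain q b where q: "p = q @ [b]" and ql: "q \<in> tree_level d m"
        by (cases p rule: rev_cases) (auto simp: tree_level_def)
      have qV: "q \<in> tree_verts d n" using q pV by (auto simp: V)
      have fq: "f q \<in> tree_level d m"
        using less.IH[of m q] less.prems ql Suc m by simp
      have "tree_adj (f q) (f p)"
        using adj[OF qV pV] by (simp add: tree_adj_def q)
      then have "(\<exists>i. f p = f q @ [i]) \<or> (\<exists>i. f q = f p @ [i])"
        unfolding tree_adj_def .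
      moreover have "length (f q) < length (f p)"
        using fq fp m by (simp add: tree_level_def)
      then have "\<not> (\<exists>i. f q = f p @ [i])" by force
      ultimately obtain i where "f p = f q @ [i]" by blast
      with 2 have "f q = f u" by (metis butlast_snoc)
      then have "q = u"
        using inj_onD[OF bij_betw_imp_inj_on[OF fB]] qV uV by blast
      then show ?thesis using u q by simp
    qed
  qed
qed

lemma tree_aut_bij_level:
  assumes f: "f \<in> tree_aut d n" and k: "k \<le> n"
  shows "bij_betw f (tree_level d k) (tree_level d k)"
proof -
  have "inj_on f (tree_level d k)"
  proof (rule inj_on_subset)
    show "inj_on f (tree_verts d n)"
      using f by (auto simp: tree_aut_def Bij_def bij_betw_def)
    show "tree_level d k \<subseteq> tree_verts d n"
      using k by (auto simp: tree_verts_def)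
  qed
  then show ?thesis
    using tree_aut_maps_level[OF f k] finite_tree_level[of d k]
    by (metis bij_betw_def endo_inj_surj image_subsetI)
qed

lemma subgroup_tree_aut: "subgroup (tree_aut d n) (BijGroup (tree_verts d n))"
proof (rule subgroup.intro)
  let ?V = "tree_verts d n"
  have root: "[] \<in> ?V" by (auto simp: tree_verts_def tree_level_def)
  show "tree_aut d n \<subseteq> carrier (BijGroup ?V)"
    by (auto simp: tree_aut_def BijGroup_def)
  show "\<one>\<^bsub>BijGroup ?V\<^esub> \<in> tree_aut d n"
    using root by (simp add: tree_aut_def BijGroup_def id_Bij)
  fix x assume x: "x \<in> tree_aut d n"
  then have xB: "x \<in> Bij ?V" by (simp add: tree_aut_def)
  have xV: "x v \<in> ?V" if "v \<in> ?V" for v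
    using Bij_imp_funcset[OF xB] that by auto
  {
    fix y assume y: "y \<in> tree_aut d n"
    then have yB: "y \<in> Bij ?V" by (simp add: tree_aut_def)
    have yV: "y v \<in> ?V" if "v \<in> ?V" for v
      using Bij_imp_funcset[OF yB] that by auto
    show "x \<otimes>\<^bsub>BijGroup ?V\<^esub> y \<in> tree_aut d n"
      using x y root xB yB yV by (simp add: BijGroup_def tree_aut_def compose_Bij compose_eq)
  }
  let ?z = "inv_into ?V x"
  have xz: "x (?z v) = v" if "v \<in> ?V" for v
    using xB that by (auto simp: Bij_def bij_betw_def f_inv_into_f)
  have zV: "?z v \<in> ?V" if "v \<in> ?V" for v
    using Bij_inv_into_mem[OF xB that] .
  have "?z [] = []"
    using x xB root inv_into_f_f[of x ?V "[]"] by (auto simp: tree_aut_def Bij_def bij_betw_def)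
  moreover have "tree_adj (?z u) (?z v) \<longleftrightarrow> tree_adj u v" if "u \<in> ?V" "v \<in> ?V" for u v
  proof -
    have "tree_adj (x (?z u)) (x (?z v)) \<longleftrightarrow> tree_adj (?z u) (?z v)"
      using x zV that unfolding tree_aut_def by blast
    then show ?thesis using xz that by simp
  qed
  ultimately show "inv\<^bsub>BijGroup ?V\<^esub> x \<in> tree_aut d n"
    using root restrict_inv_into_Bij[OF xB] by (simp add: inv_BijGroup[OF xB] tree_aut_def)
qed

lemma group_TreeAutGroup: "group (TreeAutGroup d n)"
  unfolding TreeAutGroup_def
  using subgroup.subgroup_is_group[OF subgroup_tree_aut group_BijGroup] .

lemma group_action_level:
  assumes G: "subgroup G (TreeAutGroup d n)" and k: "k \<le> n"
  shows "group_action (TreeAutGroup d n \<lparr>carrier := G\<rparr>) (tree_level d k) (level_action d k)"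
proof -
  let ?H = "TreeAutGroup d n \<lparr>carrier := G\<rparr>"
  have GA: "g \<in> tree_aut d n" if "g \<in> G" for g
    using subgroup.subset[OF G] that by (auto simp: TreeAutGroup_def)
  have B: "level_action d k g \<in> Bij (tree_level d k)" if "g \<in> G" for g
    using tree_aut_bij_level[OF GA[OF that] k]
    by (auto simp: level_action_def Bij_def cong: bij_betw_cong)
  have sub: "tree_level d k \<subseteq> tree_verts d n"
    using k by (auto simp: tree_verts_def)
  have "level_action d k (g \<otimes>\<^bsub>?H\<^esub> h) =
      level_action d k g \<otimes>\<^bsub>BijGroup (tree_level d k)\<^esub> level_action d k h"
    if gh: "g \<in> G" "h \<in> G" for g h
  proof -
    have "g \<in> Bij (tree_verts d n)" "h \<in> Bij (tree_verts d n)"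
      using GA gh by (auto simp: tree_aut_def)
    then show ?thesis
      using B[OF gh(1)] B[OF gh(2)] sub tree_aut_maps_level[OF GA[OF gh(2)] k]
      by (auto simp: TreeAutGroup_def BijGroup_def level_action_def compose_def restrict_def
          fun_eq_iff)
  qed
  then have "level_action d k \<in> hom ?H (BijGroup (tree_level d k))"
    using B by (auto simp: hom_def BijGroup_def)
  then show ?thesis
    unfolding group_action_def group_hom_def group_hom_axioms_def
    using subgroup.subgroup_is_group[OF G group_TreeAutGroup] group_BijGroup by blast
qed

end

theory Submission
  imports
    Defs
    "HOL-Computational_Algebra.Primes"
begin

text \<open>The \<open>d\<^sup>n\<close>-cycle \<open>\<sigma>\<close> identifies \<open>R\<^sub>n\<close> with \<open>\<int>/d\<^sup>n\<close>, so that every block is a coset of some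
  \<open>m\<int>/d\<^sup>n\<close> with \<open>m dvd d\<^sup>n\<close>, and the major branches are the residue classes modulo \<open>d\<close>.  The set
  of branches meeting a block is itself a block of \<open>R\<^sub>1\<close>; by primitivity it is all of \<open>R\<^sub>1\<close> as
  soon as it has two elements.  Then \<open>m\<close> is coprime to \<open>d\<close>, which together with \<open>m dvd d\<^sup>n\<close>
  forces \<open>m = 1\<close>.\<close>

section \<open>Iterates of one cyclic permutation\<close>

lemma funpow_mem:
  assumes "\<And>y. y \<in> S \<Longrightarrow> s y \<in> S" and "x \<in> S"
  shows "(s ^^ i) x \<in> S"
  using assms by (induction i) auto

lemma inj_on_funpow:
  assumes s: "inj_on s S" and mem: "\<And>y. y \<in> S \<Longrightarrow> s y \<in> S"
  shows "inj_on (s ^^ i) S"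
proof (induction i)
  case (Suc i)
  have "(s ^^ i) ` S \<subseteq> S"
    using funpow_mem[of S s, OF mem] by blast
  then have "inj_on (s \<circ> (s ^^ i)) S"
    using Suc.IH inj_on_subset[OF s] by (intro comp_inj_on)
  then show ?case by (simp only: funpow.simps)
qed simp

text \<open>By pigeonhole two of the first \<open>card S + 1\<close> iterates of \<open>x\<close>
  agree. Injectivity cancels the smaller exponent and gives a period \<open>e\<close> of
  \<open>x\<close> with \<open>e \<le> card S\<close>; as the orbit has at most \<open>e\<close>
  points, equality holds.\<close>

lemma funpow_card_orbit:
  assumes s: "inj_on s S" and mem: "\<And>y. y \<in> S \<Longrightarrow> s y \<in> S"
    and fin: "finite S" and x: "x \<in> S" and orb: "S = range (\<lambda>i. (s ^^ i) x)"
  shows "(s ^^ card S) x = x"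
proof -
  let ?p = "\<lambda>i. (s ^^ i) x"
  have "\<not> inj_on ?p {..card S}"
  proof
    assume "inj_on ?p {..card S}"
    then have "card {..card S} \<le> card S"
      using orb fin by (intro card_inj_on_le) auto
    then show False by simp
  qed
  then obtain i j where ij: "i < j" "j \<le> card S" "?p i = ?p j"
    unfolding inj_on_def by (metis atMost_iff linorder_neqE_nat)
  define e where "e = j - i"
  have e: "0 < e" "e \<le> card S" and j: "j = i + e"
    using ij by (auto simp: e_def)
  have "(s ^^ i) (?p e) = (s ^^ i) x"
    using ij(3) unfolding j funpow_add by simp
  then have pe: "?p e = x"
    using inj_onD[OF inj_on_funpow[of s S i, OF s mem]] funpow_mem[of S s, OF mem x] x by blast
  have "S \<subseteq> ?p ` {..<e}"
  proof
    fix y assume "y \<in> S"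
    with orb obtain k where "y = ?p k" by blast
    then have "y = ?p (k mod e)"
      using funpow_mod_eq[OF pe] by metis
    then show "y \<in> ?p ` {..<e}" using e by auto
  qed
  then have "card S \<le> e" by (metis card_lessThan finite_lessThan surj_card_le)
  with e pe show ?thesis by simp
qed

text \<open>Identifying \<open>S\<close> with \<open>\<int>/N\<close> through the cycle \<open>s\<close>, the block \<open>C\<close> is a coset of the
  subgroup generated by \<open>m\<close>.\<close>

lemma block_of_cyclic_action:
  assumes s: "inj_on s S" and mem: "\<And>y. y \<in> S \<Longrightarrow> s y \<in> S"
    and fin: "finite S" and orb: "S = range (\<lambda>i. (s ^^ i) c)"
    and c: "c \<in> C" and sub: "C \<subseteq> S"
    and block: "\<And>i. (s ^^ i) c \<in> C \<Longrightarrow> (s ^^ i) ` C = C"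
  obtains m where "m * card C = card S" and "C = range (\<lambda>j. (s ^^ (m * j)) c)"
proof -
  have cS: "c \<in> S" using c sub by blast
  have N: "(s ^^ card S) c = c"
    using funpow_card_orbit[of s S, OF s mem fin cS orb] .
  have N0: "0 < card S" using cS fin by (auto simp: card_gt_0_iff)
  define m where "m = (LEAST i. 0 < i \<and> (s ^^ i) c \<in> C)"
  have ex: "0 < card S \<and> (s ^^ card S) c \<in> C" using N N0 c by simp
  have m: "0 < m" "(s ^^ m) c \<in> C"
    using LeastI[of "\<lambda>i. 0 < i \<and> (s ^^ i) c \<in> C", OF ex] by (simp_all add: m_def)
  have least: "i = 0" if "i < m" "(s ^^ i) c \<in> C" for i
    using not_less_Least[of i "\<lambda>i. 0 < i \<and> (s ^^ i) c \<in> C"] that by (auto simp: m_def)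
  have mult: "(s ^^ (m * j)) ` C = C" for j
  proof (induction j)
    case (Suc j)
    have "(s ^^ (m * Suc j)) ` C = (s ^^ m) ` (s ^^ (m * j)) ` C"
      by (simp add: funpow_add image_comp)
    then show ?case using Suc.IH block[OF m(2)] by simp
  qed simp
  \<comment> \<open>Divide \<open>i\<close> by \<open>m\<close>: the iterate with exponent
    \<open>m * (i div m)\<close> is injective and permutes \<open>C\<close>, so the remainder alone
    already brings \<open>c\<close> into \<open>C\<close>, and minimality of \<open>m\<close> makes
    it 0.\<close>
  have dvd: "m dvd i" if i: "(s ^^ i) c \<in> C" for i
  proof -
    have "(s ^^ (m * (i div m))) ((s ^^ (i mod m)) c) = (s ^^ i) c"
      by (metis comp_apply funpow_add mult_div_mod_eq)
    then obtain z where z: "z \<in> C"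
      "(s ^^ (m * (i div m))) ((s ^^ (i mod m)) c) = (s ^^ (m * (i div m))) z"
      using i mult[of "i div m"] by (metis imageE)
    then have "(s ^^ (i mod m)) c = z"
      using inj_onD[OF inj_on_funpow[of s S, OF s mem]] funpow_mem[of S s, OF mem cS] sub
      by blast
    then have "i mod m = 0" using least z m by simp
    then show ?thesis by (simp add: dvd_eq_mod_eq_0)
  qed
  have C: "C = range (\<lambda>j. (s ^^ (m * j)) c)"
  proof
    show "range (\<lambda>j. (s ^^ (m * j)) c) \<subseteq> C" using mult c by blast
    show "C \<subseteq> range (\<lambda>j. (s ^^ (m * j)) c)"
    proof
      fix y assume y: "y \<in> C"
      with sub orb obtain i where i: "y = (s ^^ i) c" by blast
      then obtain j where "i = m * j" using y dvd by blast
      with i show "y \<in> range (\<lambda>j. (s ^^ (m * j)) c)" by simp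
    qed
  qed
  obtain k where k: "card S = m * k" using dvd[of "card S"] ex by blast
  \<comment> \<open>The \<open>card S\<close> exponents below \<open>card S\<close> reach all of
    \<open>S\<close>, so no two of them reach the same point.\<close>
  have injp: "inj_on (\<lambda>i. (s ^^ i) c) {..<card S}"
  proof (rule eq_card_imp_inj_on)
    have "S \<subseteq> (\<lambda>i. (s ^^ i) c) ` {..<card S}"
    proof
      fix y assume "y \<in> S"
      with orb obtain i where "y = (s ^^ i) c" by blast
      then have "y = (s ^^ (i mod card S)) c" using funpow_mod_eq[OF N] by metis
      then show "y \<in> (\<lambda>i. (s ^^ i) c) ` {..<card S}" using N0 by auto
    qed
    then have "(\<lambda>i. (s ^^ i) c) ` {..<card S} = S" using orb by blast
    then show "card ((\<lambda>i. (s ^^ i) c) ` {..<card S}) = card {..<card S}" by simp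
  qed simp
  have fk: "(s ^^ (m * k)) c = c" using N k by simp
  have "C = (\<lambda>j. (s ^^ (m * j)) c) ` {..<k}"
  proof -
    have "(s ^^ (m * j)) c \<in> (\<lambda>j. (s ^^ (m * j)) c) ` {..<k}" for j
    proof
      show "(s ^^ (m * j)) c = (s ^^ (m * (j mod k))) c"
        using funpow_mod_eq[OF fk, of "m * j"] by simp
      show "j mod k \<in> {..<k}" using N0 k by simp
    qed
    then show ?thesis unfolding C by blast
  qed
  moreover have "inj_on (\<lambda>j. (s ^^ (m * j)) c) {..<k}"
  proof (rule inj_onI)
    fix i j assume "i \<in> {..<k}" "j \<in> {..<k}" "(s ^^ (m * i)) c = (s ^^ (m * j)) c"
    then show "i = j" using inj_onD[OF injp, of "m * i" "m * j"] m(1) k by simp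
  qed
  ultimately have "card C = k" using card_image by fastforce
  with k have "m * card C = card S" by simp
  then show ?thesis using that C by blast
qed

text \<open>Exponents divisible by \<open>m\<close> are divisible by \<open>r\<close>, and since
  \<open>card T\<close> is a period of \<open>x\<close>, such exponents reach at most
  \<open>card T div r\<close> points.\<close>

lemma not_transitive_power_of_cycle:
  assumes f: "inj_on f T" and mem: "\<And>y. y \<in> T \<Longrightarrow> f y \<in> T" and fin: "finite T"
    and x: "x \<in> T" and orb: "T = range (\<lambda>i. (f ^^ i) x)"
    and r: "r dvd card T" "r dvd m" "r > 1"
  shows "range (\<lambda>j. (f ^^ (m * j)) x) \<noteq> T"
proof
  assume T: "range (\<lambda>j. (f ^^ (m * j)) x) = T"
  obtain e where e: "card T = r * e" using r by blast
  obtain b where b: "m = r * b" using r by blast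
  have "card T > 0" using x fin by (auto simp: card_gt_0_iff)
  then have e0: "e > 0" using e by simp
  have fix_x: "(f ^^ (r * e)) x = x"
    using funpow_card_orbit[of f T, OF f mem fin x orb] e by simp
  have "T \<subseteq> (\<lambda>i. (f ^^ (r * i)) x) ` {..<e}"
  proof
    fix y assume "y \<in> T"
    then obtain j where "y = (f ^^ (r * (b * j))) x"
      using T b by (auto simp: mult.assoc)
    then have "y = (f ^^ (r * (b * j mod e))) x"
      using funpow_mod_eq[OF fix_x, of "r * (b * j)"] by simp
    then show "y \<in> (\<lambda>i. (f ^^ (r * i)) x) ` {..<e}" using e0 by auto
  qed
  then have "card T \<le> e" by (metis card_lessThan finite_lessThan surj_card_le)
  then show False using e e0 r by simp
qed

section \<open>Blocks of a group action\<close>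

context group_action
begin

text \<open>By conjugation: \<open>h\<close> meets the translate as
  \<open>inv g \<otimes> h \<otimes> g\<close> meets \<open>B\<close>.\<close>

lemma is_block_image:
  assumes B: "is_block G E \<phi> B" and g: "g \<in> carrier G"
  shows "is_block G E \<phi> (\<phi> g ` B)"
  unfolding is_block_def
proof (intro conjI ballI)
  interpret G: group G using group_hom group_hom.axioms(1) by blast
  have sub: "B \<subseteq> E" using B by (simp add: is_block_def)
  then show "\<phi> g ` B \<subseteq> E" using element_image[OF g] by blast
  fix h assume h: "h \<in> carrier G"
  let ?k = "inv g \<otimes> h \<otimes> g"
  have k: "?k \<in> carrier G" using g h by simp
  have "g \<otimes> ?k = h \<otimes> g" using g h by (simp add: G.m_assoc[symmetric])
  then have "\<phi> g (\<phi> ?k x) = \<phi> h (\<phi> g x)" if "x \<in> B" for x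
    using composition_rule[of x g ?k] composition_rule[of x h g] that sub g h k by auto
  then have "\<phi> h ` \<phi> g ` B = \<phi> g ` \<phi> ?k ` B"
    by (auto simp: image_image intro!: image_cong)
  moreover have "\<phi> ?k ` B \<subseteq> E" using element_image[OF k] sub by blast
  then have "\<phi> g ` \<phi> ?k ` B \<inter> \<phi> g ` B = \<phi> g ` (\<phi> ?k ` B \<inter> B)"
    using inj_on_image_Int[OF inj_prop[OF g]] sub by metis
  ultimately show "\<phi> h ` \<phi> g ` B \<inter> \<phi> g ` B = \<phi> g ` B \<or> \<phi> h ` \<phi> g ` B \<inter> \<phi> g ` B = {}"
    using B k unfolding is_block_def by (metis image_empty)
qed

text \<open>The block property only gives that \<open>B\<close> lies in its translate; finiteness
  turns this into equality.\<close>

lemma is_block_stable: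
  assumes B: "is_block G E \<phi> B" and fin: "finite E"
    and g: "g \<in> carrier G" and x: "x \<in> B" "\<phi> g x \<in> B"
  shows "\<phi> g ` B = B"
proof -
  have "\<phi> g ` B \<inter> B \<noteq> {}" using x by blast
  then have sub: "B \<subseteq> \<phi> g ` B" using B g unfolding is_block_def by blast
  have "finite B" using B fin by (auto simp: is_block_def intro: finite_subset)
  then show ?thesis using sub by (metis card_image_le card_seteq finite_imageI)
qed

lemma action_funpow:
  fixes i :: nat
  assumes g: "g \<in> carrier G" and x: "x \<in> E"
  shows "(\<phi> g ^^ i) x = \<phi> (g [^] i) x"
proof (induction i)
  case 0
  then show ?case using x by (simp add: id_eq_one[symmetric])
next
  interpret G: group G using group_hom group_hom.axioms(1) by blast
  case (Suc i)
  have "g [^] Suc i = g \<otimes> g [^] i" using g by (rule G.nat_pow_Suc2)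
  then show ?case
    using Suc.IH composition_rule[OF x g, of "g [^] i"] g by simp
qed

text \<open>Iterates of \<open>\<phi> g\<close> are the actions of powers of \<open>g\<close>, so
  the block property applies to them. The first equation determines \<open>m\<close> by
  \<open>card C\<close> alone, which makes blocks of equal size comparable.\<close>

lemma block_of_cyclic_subgroup:
  assumes fin: "finite E" and g: "g \<in> carrier G"
    and orb: "\<And>x. x \<in> E \<Longrightarrow> E = range (\<lambda>i. (\<phi> g ^^ i) x)"
    and C: "is_block G E \<phi> C" and x: "x \<in> C"
  obtains m where "m * card C = card E" and "C = range (\<lambda>j. (\<phi> g ^^ (m * j)) x)"
proof -
  interpret G: group G using group_hom group_hom.axioms(1) by blast
  have sub: "C \<subseteq> E" using C by (simp add: is_block_def)
  have stable: "(\<phi> g ^^ i) ` C = C" if "(\<phi> g ^^ i) x \<in> C" for i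
  proof -
    have eq: "(\<phi> g ^^ i) y = \<phi> (g [^] i) y" if "y \<in> C" for y
      using action_funpow[OF g] sub that by blast
    have "\<phi> (g [^] i) ` C = C"
      using is_block_stable[OF C fin _ x] g eq[OF x] that by simp
    then show ?thesis using eq by (simp cong: image_cong)
  qed
  have xE: "x \<in> E" using x sub by blast
  show thesis
    using block_of_cyclic_action[of "\<phi> g" E x C, OF inj_prop[OF g] _ fin orb[OF xE] x sub stable]
      element_image[OF g] that by blast
qed

text \<open>The equivalence relation of the \<open>G\<close>-translates of \<open>C\<close> and that of the fibres of \<open>\<pi>\<close> are
  both given by cosets in the cyclic group of \<open>\<sigma>\<close>, so they commute.  Hence their composition
  is an equivalence relation and the union of the fibres meeting \<open>C\<close> is again a block.\<close>

lemma is_block_projection: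
  assumes act: "group_action G T \<psi>"
    and proj: "\<And>x. x \<in> E \<Longrightarrow> \<pi> x \<in> T"
    and equiv: "\<And>g x. g \<in> carrier G \<Longrightarrow> x \<in> E \<Longrightarrow> \<pi> (\<phi> g x) = \<psi> g (\<pi> x)"
    and fin: "finite E" and \<sigma>: "\<sigma> \<in> carrier G"
    and orb: "\<And>x. x \<in> E \<Longrightarrow> E = range (\<lambda>i. (\<phi> \<sigma> ^^ i) x)"
    and C: "is_block G E \<phi> C"
  shows "is_block G T \<psi> (\<pi> ` C)"
  unfolding is_block_def
proof (intro conjI ballI)
  interpret T: group_action G T \<psi> by (rule act)
  interpret G: group G using group_hom group_hom.axioms(1) by blast
  have sub: "C \<subseteq> E" using C by (simp add: is_block_def)
  then show "\<pi> ` C \<subseteq> T" using proj by blast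
  have pi_pow: "\<pi> ((\<phi> \<sigma> ^^ i) x) = (\<psi> \<sigma> ^^ i) (\<pi> x)" if "x \<in> E" for x i
    using that equiv \<sigma> action_funpow T.action_funpow proj by simp
  fix g assume g: "g \<in> carrier G"
  show "\<psi> g ` \<pi> ` C \<inter> \<pi> ` C = \<pi> ` C \<or> \<psi> g ` \<pi> ` C \<inter> \<pi> ` C = {}"
  proof (cases "\<psi> g ` \<pi> ` C \<inter> \<pi> ` C = {}")
    case False
    then obtain c c' where c: "c \<in> C" "c' \<in> C" and eq: "\<psi> g (\<pi> c) = \<pi> c'" by blast
    let ?D = "\<phi> g ` C"
    have gc: "\<phi> g c \<in> ?D" using c by blast
    have DE: "?D \<subseteq> E" using sub element_image[OF g] by blast
    have cD: "card ?D = card C"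
      using card_image inj_on_subset[OF inj_prop[OF g] sub] by blast
    have finC: "finite C" using sub fin finite_subset by blast
    then have C0: "card C > 0" using c by (auto simp: card_gt_0_iff)
    obtain m where m: "m * card C = card E" "C = range (\<lambda>j. (\<phi> \<sigma> ^^ (m * j)) c')"
      by (rule block_of_cyclic_subgroup[OF fin \<sigma> orb C c(2)])
    obtain m' where m': "m' * card C = card E" "?D = range (\<lambda>j. (\<phi> \<sigma> ^^ (m' * j)) (\<phi> g c))"
      using block_of_cyclic_subgroup[OF fin \<sigma> orb is_block_image[OF C g] gc] cD by metis
    \<comment> \<open>\<open>C\<close> and its translate have equal size, hence the same step
      width.\<close>
    have [simp]: "m' = m" using m(1) m'(1) C0 by (metis mult_cancel2 less_irrefl)
    have c'E: "c' \<in> E" and gcE: "\<phi> g c \<in> E" and cE: "c \<in> E" using c gc sub DE by blast+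
    have pi_eq: "\<pi> (\<phi> g c) = \<pi> c'" using equiv[OF g cE] eq by simp
    \<comment> \<open>Both blocks run in steps of \<open>m\<close> from points of the same fibre,
      and \<open>\<pi>\<close> intertwines the two actions of \<open>\<sigma>\<close>.\<close>
    have "\<pi> ` ?D = range (\<lambda>j. \<pi> ((\<phi> \<sigma> ^^ (m * j)) (\<phi> g c)))"
      using m'(2) by (auto simp: image_image)
    also have "\<dots> = range (\<lambda>j. \<pi> ((\<phi> \<sigma> ^^ (m * j)) c'))"
      using pi_pow gcE c'E pi_eq by simp
    also have "\<dots> = \<pi> ` C" using m(2) by (metis image_image)
    finally have "\<pi> ` ?D = \<pi> ` C" .
    moreover have "\<psi> g ` \<pi> ` C = \<pi> ` ?D"
      using equiv[OF g] sub by (auto simp: image_image intro!: image_cong)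
    ultimately show ?thesis by simp
  qed simp
qed

text \<open>Of the tree only an equivariant surjection \<open>\<pi>\<close> and the count
  \<open>card E = card T ^ n\<close> remain; the count makes every prime divisor of \<open>m\<close>
  divide \<open>card T\<close>.\<close>

lemma block_eq_all:
  assumes act: "group_action G T \<psi>"
    and proj: "\<pi> ` E = T"
    and equiv: "\<And>g x. g \<in> carrier G \<Longrightarrow> x \<in> E \<Longrightarrow> \<pi> (\<phi> g x) = \<psi> g (\<pi> x)"
    and fin: "finite E" and card: "card E = card T ^ n"
    and \<sigma>: "\<sigma> \<in> carrier G"
    and orb: "\<And>x. x \<in> E \<Longrightarrow> E = range (\<lambda>i. (\<phi> \<sigma> ^^ i) x)"
    and prim: "primitive_action G T \<psi>"
    and C: "is_block G E \<phi> C"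
    and x: "x \<in> C" and y: "y \<in> C" and xy: "\<pi> x \<noteq> \<pi> y"
  shows "C = E"
proof -
  interpret T: group_action G T \<psi> by (rule act)
  interpret G: group G using group_hom group_hom.axioms(1) by blast
  have projT: "\<pi> z \<in> T" if "z \<in> E" for z using proj that by blast
  have sub: "C \<subseteq> E" using C by (simp add: is_block_def)
  have xE: "x \<in> E" using x sub by blast
  have "is_block G T \<psi> (\<pi> ` C)"
    by (rule is_block_projection[of T \<psi> \<pi> \<sigma> C, OF act projT equiv fin \<sigma> orb C])
  then have "\<pi> ` C = T"
    using prim x y xy unfolding primitive_action_def by (metis empty_iff imageI singletonD)
  obtain m where m: "m * card C = card E" "C = range (\<lambda>j. (\<phi> \<sigma> ^^ (m * j)) x)"
    by (rule block_of_cyclic_subgroup[OF fin \<sigma> orb C x])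
  have pi_pow: "\<pi> ((\<phi> \<sigma> ^^ i) x) = (\<psi> \<sigma> ^^ i) (\<pi> x)" for i
    using xE equiv \<sigma> action_funpow T.action_funpow projT by simp
  have orbT: "T = range (\<lambda>i. (\<psi> \<sigma> ^^ i) (\<pi> x))"
  proof -
    have "T = \<pi> ` range (\<lambda>i. (\<phi> \<sigma> ^^ i) x)" using proj orb[OF xE] by simp
    then show ?thesis using pi_pow by (simp add: image_image)
  qed
  have mT: "range (\<lambda>j. (\<psi> \<sigma> ^^ (m * j)) (\<pi> x)) = T"
  proof -
    have "T = \<pi> ` range (\<lambda>j. (\<phi> \<sigma> ^^ (m * j)) x)" using \<open>\<pi> ` C = T\<close> m(2) by simp
    then show ?thesis using pi_pow by (simp add: image_image)
  qed
  have "m = 1"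
  proof (rule ccontr)
    assume "m \<noteq> 1"
    then obtain r where r: "prime r" "r dvd m" using prime_factor_nat by blast
    then have "r dvd card T ^ n" using m(1) card by (metis dvd_mult2)
    then have "r dvd card T" using r(1) prime_dvd_power by blast
    \<comment> \<open>Steps divisible by \<open>r\<close> cannot exhaust a cycle whose length
      \<open>r\<close> divides, contrary to \<open>mT\<close>.\<close>
    then show False
      using not_transitive_power_of_cycle[of "\<psi> \<sigma>" T "\<pi> x" r m, OF T.inj_prop[OF \<sigma>] _ _ _ orbT]
        T.element_image[OF \<sigma>] fin proj projT[OF xE] r prime_gt_1_nat mT by blast
  qed
  then show "C = E" using m(2) orb[OF xE] by simp
qed

end

section \<open>Full cycles, and ancestors under tree automorphisms\<close>

text \<open>Iterating the cycle rotates its list, so the iterates of \<open>x\<close> run through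
  all positions modulo the length.\<close>

lemma full_cycle_orbit:
  assumes "acts_as_full_cycle s S" and x: "x \<in> S"
  shows "S = range (\<lambda>i. (s ^^ i) x)"
proof -
  obtain cs where cs: "distinct cs" "set cs = S" and s: "\<And>x. x \<in> S \<Longrightarrow> s x = cycle_of_list cs x"
    using assms by (auto simp: acts_as_full_cycle_def)
  obtain k where k: "k < length cs" "x = cs ! k" using x cs by (auto simp: in_set_conv_nth)
  have cyc: "(cycle_of_list cs ^^ i) x = cs ! ((i + k) mod length cs)" for i
  proof -
    have "(cycle_of_list cs ^^ i) x = map (cycle_of_list cs ^^ i) cs ! k" using k by simp
    also have "\<dots> = rotate i cs ! k" using cyclic_rotation[OF cs(1)] by simp
    also have "\<dots> = cs ! ((i + k) mod length cs)" using k by (simp add: nth_rotate)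
    finally show ?thesis .
  qed
  have inS: "(cycle_of_list cs ^^ i) x \<in> S" for i
    using cyc[of i] k cs by (metis length_pos_if_in_set mod_less_divisor nth_mem)
  have eq: "(s ^^ i) x = (cycle_of_list cs ^^ i) x" for i
    by (induction i) (simp_all add: s inS)
  have "\<exists>i. y = (s ^^ i) x" if y: "y \<in> S" for y
  proof -
    obtain j where j: "j < length cs" "y = cs ! j" using y cs(2) by (auto simp: in_set_conv_nth)
    \<comment> \<open>Starting from \<open>length cs - k\<close> avoids truncated subtraction when
      \<open>j < k\<close>.\<close>
    have "(length cs - k + j + k) mod length cs = j" using k j by simp
    then have "y = (s ^^ (length cs - k + j)) x" using eq cyc j(2) by simp
    then show ?thesis by blast
  qed
  then show ?thesis using eq inS by auto
qed

text \<open>\<open>take j\<close> gives the ancestor at level \<open>j\<close>. Levels and adjacency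
  are preserved, so children of \<open>p\<close> go to children of \<open>f p\<close>, and induction
  on the level carries this to all ancestors.\<close>

lemma tree_aut_take:
  assumes f: "f \<in> tree_aut d n" and u: "u \<in> tree_level d k" and kn: "k \<le> n" and "j \<le> k"
  shows "take j (f u) = f (take j u)"
  using u kn \<open>j \<le> k\<close>
proof (induction k arbitrary: u)
  case 0
  then show ?case using tree_aut_maps_level[OF f, of 0 u] by (simp add: tree_level_def)
next
  case (Suc k)
  show ?case
  proof (cases "j = Suc k")
    case True
    then show ?thesis
      using Suc.prems tree_aut_maps_level[OF f, of "Suc k" u] by (simp add: tree_level_def)
  next
    case False
    obtain p i where p: "u = p @ [i]" "p \<in> tree_level d k"
      using Suc.prems by (cases u rule: rev_cases) (auto simp: tree_level_def)
    have fp: "f p \<in> tree_level d k" and fu: "f u \<in> tree_level d (Suc k)"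
      using tree_aut_maps_level[OF f] p Suc.prems by auto
    have "p \<in> tree_verts d n" "u \<in> tree_verts d n"
      using p Suc.prems unfolding tree_verts_def by auto
    then have "tree_adj (f p) (f u)"
      using f p unfolding tree_aut_def by (auto simp: tree_adj_def)
    moreover have "length (f p) < length (f u)"
      using fp fu by (simp add: tree_level_def)
    ultimately obtain a where a: "f u = f p @ [a]"
      unfolding tree_adj_def by force
    have "j \<le> k" using False Suc.prems by simp
    then have "take j (f p) = f (take j p)"
      using Suc.IH[OF p(2)] Suc.prems by simp
    moreover have "take j (f u) = take j (f p)" "take j u = take j p"
      using a p fp \<open>j \<le> k\<close> by (simp_all add: tree_level_def)
    ultimately show ?thesis by simp
  qed
qed

theorem theorem4p3:
  fixes d n :: nat
    and E :: "nat list set"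
    and G :: "(nat list \<Rightarrow> nat list) set"
    and \<sigma> :: "nat list \<Rightarrow> nat list"
  assumes "d \<ge> 2" and "n \<ge> 1"
    and "E \<subseteq> tree_level d n"
    and "\<exists>X \<in> major_branches d n. \<exists>Y \<in> major_branches d n.
           X \<noteq> Y \<and> E \<inter> X \<noteq> {} \<and> E \<inter> Y \<noteq> {}"
    and "subgroup G (TreeAutGroup d n)"
    and "\<sigma> \<in> G" and "acts_as_full_cycle \<sigma> (tree_level d n)"
    and "primitive_action (restricted_group d 1 G) (tree_level d 1) (\<lambda>g. g)"
  shows "is_smallest_block (TreeAutGroup d n \<lparr>carrier := G\<rparr>) (tree_level d n)
           (level_action d n) E (tree_level d n)"
proof -
  let ?H = "TreeAutGroup d n \<lparr>carrier := G\<rparr>"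
  interpret group_action ?H "tree_level d n" "level_action d n"
    by (rule group_action_level[OF assms(5)]) simp
  have act1: "group_action ?H (tree_level d 1) (level_action d 1)"
    by (rule group_action_level[OF assms(5,2)])
  have aut: "g \<in> tree_aut d n" if "g \<in> G" for g
    using subgroup.subset[OF assms(5)] that by (auto simp: TreeAutGroup_def)
  \<comment> \<open>\<open>take 1\<close> sends a vertex to the root of its major branch and serves
    as \<open>\<pi>\<close>.\<close>
  have take1: "take 1 x \<in> tree_level d 1" if "x \<in> tree_level d n" for x
    using that assms(2) by (auto simp: tree_level_def dest: in_set_takeD)
  have proj: "take 1 ` tree_level d n = tree_level d 1"
  proof
    show "take 1 ` tree_level d n \<subseteq> tree_level d 1" using take1 by blast
    show "tree_level d 1 \<subseteq> take 1 ` tree_level d n"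
    proof
      fix u assume u: "u \<in> tree_level d 1"
      \<comment> \<open>Any descendant would do; 0 is a legal letter because \<open>d\<close> is
        positive.\<close>
      then have "u @ replicate (n - 1) 0 \<in> tree_level d n"
        using assms(1,2) by (auto simp: tree_level_def)
      moreover have "take 1 (u @ replicate (n - 1) 0) = u"
        using u by (simp add: tree_level_def)
      ultimately show "u \<in> take 1 ` tree_level d n" by (metis imageI)
    qed
  qed
  have equiv: "take 1 (level_action d n g x) = level_action d 1 g (take 1 x)"
    if "g \<in> carrier ?H" "x \<in> tree_level d n" for g x
    using that tree_aut_take[OF aut, of g x n 1] take1 assms(2) by (simp add: level_action_def)
  \<comment> \<open>Being a block depends only on the set of induced permutations, which is the same
    for \<open>G\<close> and for its restriction to level 1.\<close>
  have prim: "primitive_action ?H (tree_level d 1) (level_action d 1)"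
    using assms(8) by (simp add: primitive_action_def is_block_def restricted_group_def)
  have orb: "tree_level d n = range (\<lambda>i. (level_action d n \<sigma> ^^ i) x)"
    if "x \<in> tree_level d n" for x
  proof (rule full_cycle_orbit[OF _ that])
    show "acts_as_full_cycle (level_action d n \<sigma>) (tree_level d n)"
      using assms(7) by (simp add: acts_as_full_cycle_def level_action_def)
  qed
  obtain X Y x y where "X \<in> major_branches d n" "Y \<in> major_branches d n" "X \<noteq> Y"
    "x \<in> E" "x \<in> X" "y \<in> E" "y \<in> Y"
    using assms(4) by blast
  \<comment> \<open>The root of a major branch can be read off any of its points, so points of
    distinct branches have distinct images.\<close>
  moreover have "take 1 v = u" if "u \<in> tree_level d 1" "prefix u v" for u v
    using that by (auto simp: tree_level_def prefix_def)
  ultimately have xy: "x \<in> E" "y \<in> E" "take 1 x \<noteq> take 1 y"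
    by (auto simp: major_branches_def major_branch_def)
  have "C = tree_level d n" if C: "is_block ?H (tree_level d n) (level_action d n) C" "E \<subseteq> C" for C
  proof (rule block_eq_all[OF act1 proj equiv finite_tree_level _ _ orb prim C(1)])
    show "card (tree_level d n) = card (tree_level d 1) ^ n" by (simp add: card_tree_level)
  qed (use xy C assms(6) in auto)
  moreover have "is_block ?H (tree_level d n) (level_action d n) (tree_level d n)"
    using surj_prop by (simp add: is_block_def)
  ultimately show ?thesis
    using assms(3) unfolding is_smallest_block_def by blast
qed

end
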